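(* Let $\mathsf{C}$ be a category with binary coproducts, $F\colon\mathsf{C}\to\mathsf{C}$ a functor and $(T,\mu,\eta)$ a monad on $\mathsf{C}$ such that: (i) $F$ lifts to $\mathcal{K}l(T)$ via a distributive law $\lambda\colon FT\Rightarrow TF$; (ii) there is an initial $(F(-)+X)$-algebra for every object $X$ and a terminal $F$-coalgebra; (iii) the category $\mathsf{Alg}(F)$ of $F$-algebras has binary coproducts. Let $\bar{T}_B\colon\mathsf{Alg}_B(F)\to\mathsf{Alg}_B(F)$ be the functor on Bloom $F$-algebras defined in the context. Then $(\bar{T}_B,\bar\mu^B,\bar\eta^B)$ is a monad on $\mathsf{Alg}_B(F)$, where for every Bloom algebra $(a\colon FA\to A,(-)^\dagger)$ the components are $$\bar\mu^B_{(a,(-)^\dagger)}=\mu_A\colon \bar{T}_B^2(a,(-)^\dagger)\to\bar{T}_B(a,(-)^\dagger),\qquad \bar\eta^B_{(a,(-)^\dagger)}=\eta_A\colon (a,(-)^\dagger)\to\bar{T}_B(a,(-)^\dagger).$$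
   Context: Distributive law: a natural transformation $\lambda\colon FT\Rightarrow TF$ with $\lambda\circ F\eta=\eta_F$ and $\lambda\circ F\mu=\mu_F\circ T\lambda\circ\lambda_T$. Bloom $F$-algebra: a pair $(a\colon FA\to A,(-)^\dagger)$, where $(-)^\dagger$ assigns to every $F$-coalgebra $e\colon X\to FX$ a map $e^\dagger\colon X\to A$ such that $e^\dagger=a\circ F(e^\dagger)\circ e$, and such that for every coalgebra homomorphism $h\colon X\to Y$ from $e\colon X\to FX$ to $f\colon Y\to FY$ (i.e. $f\circ h=Fh\circ e$) one has $f^\dagger\circ h=e^\dagger$. A homomorphism from $(a\colon FA\to A,(-)^\dagger)$ to $(b\colon FB\to B,(-)^\ddagger)$ is a map $h\colon A\to B$ with $b\circ Fh=h\circ a$ and $h\circ e^\dagger=e^\ddagger$ for every $F$-coalgebra $e$. $\mathsf{Alg}_B(F)$ is the category of Bloom algebras and their homomorphisms. The functor $\bar{T}_B$: for an $F$-algebra $a\colon FA\to A$ put $\bar{T}(a)=Ta\circ\lambda_A\colon FTA\to TFA\to TA$. Then $\bar{T}_B(a\colon FA\to A,(-)^\dagger)=(\bar{T}(a)\colon FTA\to TA,(-)^\ddagger)$, where $e^\ddagger=\eta_A\circ e^\dagger$ for every coalgebra $e\colon X\to FX$; on a homomorphism $h$, $\bar{T}_B(h)=T(h)$. *)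

theory Defs
  imports "HOL-Library.FuncSet"
begin

section \<open>Categories, functors, natural transformations, monads\<close>

record ('o, 'm) cat =
  Ob :: "'o set"
  Arr :: "'m set"
  Dom :: "'m \<Rightarrow> 'o"
  Cod :: "'m \<Rightarrow> 'o"
  Id :: "'o \<Rightarrow> 'm"
  Comp :: "'m \<Rightarrow> 'm \<Rightarrow> 'm" (infixl "\<cdot>\<index>" 70)

definition hom :: "('o, 'm) cat \<Rightarrow> 'o \<Rightarrow> 'o \<Rightarrow> 'm set" where
  "hom C X Y = {f \<in> Arr C. Dom C f = X \<and> Cod C f = Y}"

text \<open>\<open>g \<cdot> f\<close> is the composite of \<open>f\<close> followed by \<open>g\<close>; it is unconstrained when \<open>g\<close> and \<open>f\<close>
  are not composable arrows.\<close>

locale category =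
  fixes C :: "('o, 'm) cat" (structure)
  assumes Dom_in_Ob: "f \<in> Arr C \<Longrightarrow> Dom C f \<in> Ob C"
    and Cod_in_Ob: "f \<in> Arr C \<Longrightarrow> Cod C f \<in> Ob C"
    and Id_in_hom: "X \<in> Ob C \<Longrightarrow> Id C X \<in> hom C X X"
    and Comp_in_hom: "f \<in> hom C X Y \<Longrightarrow> g \<in> hom C Y Z \<Longrightarrow> g \<cdot> f \<in> hom C X Z"
    and Comp_assoc:
      "f \<in> hom C W X \<Longrightarrow> g \<in> hom C X Y \<Longrightarrow> h \<in> hom C Y Z \<Longrightarrow> h \<cdot> (g \<cdot> f) = (h \<cdot> g) \<cdot> f"
    and Id_left: "f \<in> hom C X Y \<Longrightarrow> Id C Y \<cdot> f = f"
    and Id_right: "f \<in> hom C X Y \<Longrightarrow> f \<cdot> Id C X = f"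

record ('o, 'm, 'p, 'n) fctr =
  on_ob :: "'o \<Rightarrow> 'p"
  on_arr :: "'m \<Rightarrow> 'n"

locale is_functor = C: category C + D: category D
  for C :: "('o, 'm) cat" and D :: "('p, 'n) cat" +
  fixes F :: "('o, 'm, 'p, 'n) fctr"
  assumes on_ob_in_Ob: "X \<in> Ob C \<Longrightarrow> on_ob F X \<in> Ob D"
    and on_arr_in_hom: "f \<in> hom C X Y \<Longrightarrow> on_arr F f \<in> hom D (on_ob F X) (on_ob F Y)"
    and on_arr_Id: "X \<in> Ob C \<Longrightarrow> on_arr F (Id C X) = Id D (on_ob F X)"
    and on_arr_Comp: "f \<in> hom C X Y \<Longrightarrow> g \<in> hom C Y Z \<Longrightarrow>
      on_arr F (g \<cdot>\<^bsub>C\<^esub> f) = on_arr F g \<cdot>\<^bsub>D\<^esub> on_arr F f"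

definition id_functor :: "('o, 'm, 'o, 'm) fctr" where
  "id_functor = \<lparr>on_ob = (\<lambda>X. X), on_arr = (\<lambda>f. f)\<rparr>"

definition comp_functor ::
    "('p, 'n, 'q, 'k) fctr \<Rightarrow> ('o, 'm, 'p, 'n) fctr \<Rightarrow> ('o, 'm, 'q, 'k) fctr"
    (infixl "\<circ>\<circ>" 75) where
  "G \<circ>\<circ> F = \<lparr>on_ob = on_ob G \<circ> on_ob F, on_arr = on_arr G \<circ> on_arr F\<rparr>"

locale nat_trans = F: is_functor C D F + G: is_functor C D G
  for C :: "('o, 'm) cat" and D :: "('p, 'n) cat"
    and F G :: "('o, 'm, 'p, 'n) fctr" +
  fixes \<alpha> :: "'o \<Rightarrow> 'n"
  assumes component_in_hom: "X \<in> Ob C \<Longrightarrow> \<alpha> X \<in> hom D (on_ob F X) (on_ob G X)"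
    and naturality: "f \<in> hom C X Y \<Longrightarrow> on_arr G f \<cdot>\<^bsub>D\<^esub> \<alpha> X = \<alpha> Y \<cdot>\<^bsub>D\<^esub> on_arr F f"

locale monad =
  T: is_functor C C T +
  \<mu>: nat_trans C C "T \<circ>\<circ> T" T \<mu> +
  \<eta>: nat_trans C C id_functor T \<eta>
  for C :: "('o, 'm) cat" (structure) and T :: "('o, 'm, 'o, 'm) fctr"
    and \<mu> \<eta> :: "'o \<Rightarrow> 'm" +
  assumes mult_assoc: "X \<in> Ob C \<Longrightarrow> \<mu> X \<cdot> on_arr T (\<mu> X) = \<mu> X \<cdot> \<mu> (on_ob T X)"
    and unit_left: "X \<in> Ob C \<Longrightarrow> \<mu> X \<cdot> \<eta> (on_ob T X) = Id C (on_ob T X)"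
    and unit_right: "X \<in> Ob C \<Longrightarrow> \<mu> X \<cdot> on_arr T (\<eta> X) = Id C (on_ob T X)"

locale distributive_law =
  F: is_functor C C F +
  T: monad C T \<mu> \<eta> +
  lam: nat_trans C C "F \<circ>\<circ> T" "T \<circ>\<circ> F" lam
  for C :: "('o, 'm) cat" (structure) and F T :: "('o, 'm, 'o, 'm) fctr"
    and \<mu> \<eta> lam :: "'o \<Rightarrow> 'm" +
  assumes lam_unit: "X \<in> Ob C \<Longrightarrow> lam X \<cdot> on_arr F (\<eta> X) = \<eta> (on_ob F X)"
    and lam_mult: "X \<in> Ob C \<Longrightarrow>
      lam X \<cdot> on_arr F (\<mu> X) = \<mu> (on_ob F X) \<cdot> on_arr T (lam X) \<cdot> lam (on_ob T X)"


section \<open>Initial and terminal objects, binary coproducts\<close>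

definition initial :: "('o, 'm) cat \<Rightarrow> 'o \<Rightarrow> bool" where
  "initial C I \<longleftrightarrow> I \<in> Ob C \<and> (\<forall>X\<in>Ob C. \<exists>!f. f \<in> hom C I X)"

definition terminal :: "('o, 'm) cat \<Rightarrow> 'o \<Rightarrow> bool" where
  "terminal C Z \<longleftrightarrow> Z \<in> Ob C \<and> (\<forall>X\<in>Ob C. \<exists>!f. f \<in> hom C X Z)"

text \<open>A coproduct of \<open>A\<close> and \<open>B\<close> is given by its injections; the coproduct object is their
  common codomain.\<close>

definition is_coproduct :: "('o, 'm) cat \<Rightarrow> 'o \<Rightarrow> 'o \<Rightarrow> 'm \<Rightarrow> 'm \<Rightarrow> bool" where
  "is_coproduct C A B i j \<longleftrightarrow>
     i \<in> Arr C \<and> j \<in> Arr C \<and> Dom C i = A \<and> Dom C j = B \<and> Cod C i = Cod C j \<and>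
     (\<forall>Z. \<forall>f \<in> hom C A Z. \<forall>g \<in> hom C B Z.
        \<exists>!h. h \<in> hom C (Cod C i) Z \<and> h \<cdot>\<^bsub>C\<^esub> i = f \<and> h \<cdot>\<^bsub>C\<^esub> j = g)"

definition has_binary_coproducts :: "('o, 'm) cat \<Rightarrow> bool" where
  "has_binary_coproducts C \<longleftrightarrow> (\<forall>A\<in>Ob C. \<forall>B\<in>Ob C. \<exists>i j. is_coproduct C A B i j)"

definition inj1 :: "('o, 'm) cat \<Rightarrow> 'o \<Rightarrow> 'o \<Rightarrow> 'm" where
  "inj1 C A B = fst (SOME (i, j). is_coproduct C A B i j)"

definition inj2 :: "('o, 'm) cat \<Rightarrow> 'o \<Rightarrow> 'o \<Rightarrow> 'm" where
  "inj2 C A B = snd (SOME (i, j). is_coproduct C A B i j)"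

definition coprod :: "('o, 'm) cat \<Rightarrow> 'o \<Rightarrow> 'o \<Rightarrow> 'o" where
  "coprod C A B = Cod C (inj1 C A B)"

text \<open>\<open>coprod_arr C f g\<close> is the arrow \<open>f + g: A + B \<rightarrow> A' + B'\<close> for \<open>f: A \<rightarrow> A'\<close> and \<open>g: B \<rightarrow> B'\<close>.\<close>

definition coprod_arr :: "('o, 'm) cat \<Rightarrow> 'm \<Rightarrow> 'm \<Rightarrow> 'm" where
  "coprod_arr C f g =
     (THE h. h \<in> hom C (coprod C (Dom C f) (Dom C g)) (coprod C (Cod C f) (Cod C g)) \<and>
        h \<cdot>\<^bsub>C\<^esub> inj1 C (Dom C f) (Dom C g) = inj1 C (Cod C f) (Cod C g) \<cdot>\<^bsub>C\<^esub> f \<and>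
        h \<cdot>\<^bsub>C\<^esub> inj2 C (Dom C f) (Dom C g) = inj2 C (Cod C f) (Cod C g) \<cdot>\<^bsub>C\<^esub> g)"

text \<open>The functor \<open>F(-) + X\<close>.\<close>

definition plus_const ::
    "('o, 'm) cat \<Rightarrow> ('o, 'm, 'o, 'm) fctr \<Rightarrow> 'o \<Rightarrow> ('o, 'm, 'o, 'm) fctr" where
  "plus_const C F X =
     \<lparr>on_ob = (\<lambda>Y. coprod C (on_ob F Y) X),
      on_arr = (\<lambda>f. coprod_arr C (on_arr F f) (Id C X))\<rparr>"


section \<open>Algebras, coalgebras and Bloom algebras\<close>

text \<open>The category of objects of \<open>C\<close> with extra structure: \<open>S\<close> is the collection of structured
  objects, \<open>U\<close> sends one to its underlying object and \<open>P x h y\<close> says that \<open>h\<close> preserves the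
  structure. An arrow records its source and target besides the underlying arrow of \<open>C\<close>.\<close>

definition structured_cat :: "('o, 'm) cat \<Rightarrow> 's set \<Rightarrow> ('s \<Rightarrow> 'o) \<Rightarrow> ('s \<Rightarrow> 'm \<Rightarrow> 's \<Rightarrow> bool)
    \<Rightarrow> ('s, 's \<times> 'm \<times> 's) cat" where
  "structured_cat C S U P =
     \<lparr>Ob = S,
      Arr = {(x, h, y). x \<in> S \<and> y \<in> S \<and> h \<in> hom C (U x) (U y) \<and> P x h y},
      Dom = (\<lambda>(x, h, y). x),
      Cod = (\<lambda>(x, h, y). y),
      Id = (\<lambda>x. (x, Id C (U x), x)),
      Comp = (\<lambda>(_, g, z) (x, f, _). (x, g \<cdot>\<^bsub>C\<^esub> f, z))\<rparr>"

text \<open>An algebra or coalgebra is its structure arrow, which determines the carrier: \<open>Cod C a\<close> for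
  an algebra \<open>a\<close>, \<open>Dom C e\<close> for a coalgebra \<open>e\<close>.\<close>

definition algebras :: "('o, 'm) cat \<Rightarrow> ('o, 'm, 'o, 'm) fctr \<Rightarrow> 'm set" where
  "algebras C F = {a \<in> Arr C. Dom C a = on_ob F (Cod C a)}"

definition coalgebras :: "('o, 'm) cat \<Rightarrow> ('o, 'm, 'o, 'm) fctr \<Rightarrow> 'm set" where
  "coalgebras C F = {e \<in> Arr C. Cod C e = on_ob F (Dom C e)}"

definition alg_square :: "('o, 'm) cat \<Rightarrow> ('o, 'm, 'o, 'm) fctr \<Rightarrow> 'm \<Rightarrow> 'm \<Rightarrow> 'm \<Rightarrow> bool" where
  "alg_square C F a h b \<longleftrightarrow> b \<cdot>\<^bsub>C\<^esub> on_arr F h = h \<cdot>\<^bsub>C\<^esub> a"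

definition coalg_square :: "('o, 'm) cat \<Rightarrow> ('o, 'm, 'o, 'm) fctr \<Rightarrow> 'm \<Rightarrow> 'm \<Rightarrow> 'm \<Rightarrow> bool" where
  "coalg_square C F e h f \<longleftrightarrow> f \<cdot>\<^bsub>C\<^esub> h = on_arr F h \<cdot>\<^bsub>C\<^esub> e"

definition Alg :: "('o, 'm) cat \<Rightarrow> ('o, 'm, 'o, 'm) fctr \<Rightarrow> ('m, 'm \<times> 'm \<times> 'm) cat" where
  "Alg C F = structured_cat C (algebras C F) (Cod C) (alg_square C F)"

definition Coalg :: "('o, 'm) cat \<Rightarrow> ('o, 'm, 'o, 'm) fctr \<Rightarrow> ('m, 'm \<times> 'm \<times> 'm) cat" where
  "Coalg C F = structured_cat C (coalgebras C F) (Dom C) (coalg_square C F)"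

text \<open>In a Bloom algebra \<open>(a, s)\<close> the operation \<open>e \<mapsto> s e\<close> plays the role of the dagger. It is
  defined on coalgebras only, hence the extensional function space.\<close>

type_synonym 'm bloom = "'m \<times> ('m \<Rightarrow> 'm)"

definition bloom_algebras ::
    "('o, 'm) cat \<Rightarrow> ('o, 'm, 'o, 'm) fctr \<Rightarrow> 'm bloom set" where
  "bloom_algebras C F = {(a, s).
     a \<in> algebras C F \<and>
     s \<in> (\<Pi>\<^sub>E e \<in> coalgebras C F. hom C (Dom C e) (Cod C a)) \<and>
     (\<forall>e \<in> coalgebras C F. s e = a \<cdot>\<^bsub>C\<^esub> on_arr F (s e) \<cdot>\<^bsub>C\<^esub> e) \<and>
     (\<forall>e \<in> coalgebras C F. \<forall>f \<in> coalgebras C F. \<forall>h \<in> hom C (Dom C e) (Dom C f).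
        coalg_square C F e h f \<longrightarrow> s f \<cdot>\<^bsub>C\<^esub> h = s e)}"

definition bloom_carrier :: "('o, 'm) cat \<Rightarrow> 'm bloom \<Rightarrow> 'o" where
  "bloom_carrier C A = Cod C (fst A)"

definition Alg_B ::
    "('o, 'm) cat \<Rightarrow> ('o, 'm, 'o, 'm) fctr
       \<Rightarrow> ('m bloom, 'm bloom \<times> 'm \<times> 'm bloom) cat" where
  "Alg_B C F = structured_cat C (bloom_algebras C F) (bloom_carrier C)
     (\<lambda>(a, s) h (b, t). alg_square C F a h b \<and> (\<forall>e \<in> coalgebras C F. h \<cdot>\<^bsub>C\<^esub> s e = t e))"


section \<open>The lifted functor\<close>

definition Tbar :: "('o, 'm) cat \<Rightarrow> ('o, 'm, 'o, 'm) fctr \<Rightarrow> ('o \<Rightarrow> 'm) \<Rightarrow> 'm \<Rightarrow> 'm" where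
  "Tbar C T lam a = on_arr T a \<cdot>\<^bsub>C\<^esub> lam (Cod C a)"

definition Tbar_B_ob ::
    "('o, 'm) cat \<Rightarrow> ('o, 'm, 'o, 'm) fctr \<Rightarrow> ('o, 'm, 'o, 'm) fctr \<Rightarrow> ('o \<Rightarrow> 'm) \<Rightarrow> ('o \<Rightarrow> 'm)
       \<Rightarrow> 'm bloom \<Rightarrow> 'm bloom" where
  "Tbar_B_ob C F T \<eta> lam =
     (\<lambda>(a, s). (Tbar C T lam a, \<lambda>e \<in> coalgebras C F. \<eta> (Cod C a) \<cdot>\<^bsub>C\<^esub> s e))"

definition Tbar_B ::
    "('o, 'm) cat \<Rightarrow> ('o, 'm, 'o, 'm) fctr \<Rightarrow> ('o, 'm, 'o, 'm) fctr \<Rightarrow> ('o \<Rightarrow> 'm) \<Rightarrow> ('o \<Rightarrow> 'm)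
       \<Rightarrow> ('m bloom, 'm bloom \<times> 'm \<times> 'm bloom, 'm bloom, 'm bloom \<times> 'm \<times> 'm bloom) fctr" where
  "Tbar_B C F T \<eta> lam =
     \<lparr>on_ob = Tbar_B_ob C F T \<eta> lam,
      on_arr = (\<lambda>(A, h, B). (Tbar_B_ob C F T \<eta> lam A, on_arr T h, Tbar_B_ob C F T \<eta> lam B))\<rparr>"

definition mu_B ::
    "('o, 'm) cat \<Rightarrow> ('o, 'm, 'o, 'm) fctr \<Rightarrow> ('o, 'm, 'o, 'm) fctr \<Rightarrow> ('o \<Rightarrow> 'm) \<Rightarrow> ('o \<Rightarrow> 'm)
       \<Rightarrow> ('o \<Rightarrow> 'm) \<Rightarrow> 'm bloom \<Rightarrow> 'm bloom \<times> 'm \<times> 'm bloom" where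
  "mu_B C F T \<mu> \<eta> lam A =
     (let TB = on_ob (Tbar_B C F T \<eta> lam) in (TB (TB A), \<mu> (bloom_carrier C A), TB A))"

definition eta_B ::
    "('o, 'm) cat \<Rightarrow> ('o, 'm, 'o, 'm) fctr \<Rightarrow> ('o, 'm, 'o, 'm) fctr \<Rightarrow> ('o \<Rightarrow> 'm)
       \<Rightarrow> ('o \<Rightarrow> 'm) \<Rightarrow> 'm bloom \<Rightarrow> 'm bloom \<times> 'm \<times> 'm bloom" where
  "eta_B C F T \<eta> lam A =
     (let TB = on_ob (Tbar_B C F T \<eta> lam) in (A, \<eta> (bloom_carrier C A), TB A))"

end

theory Submission
  imports Defs
begin

text \<open>A monad on \<open>C\<close> lifts to a category of structured objects over \<open>C\<close> as soon as its functor part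
  acts on structured objects and \<open>T h\<close>, \<open>\<mu>\<close> and \<open>\<eta>\<close> preserve the structure: the monad laws hold
  because they hold in \<open>C\<close>. For Bloom algebras, the algebra part of this is the usual lifting along
  a distributive law. Since the dagger on \<open>T A\<close> is \<open>\<eta>\<^sub>A \<circ> (-)\<^sup>\<dagger>\<close>, preservation of daggers is
  naturality of \<open>\<eta>\<close> for \<open>T h\<close>, trivial for \<open>\<eta>\<close>, and a unit law for \<open>\<mu>\<close>; that the new dagger solves its
  equation is the fact that \<open>\<eta>\<^sub>A\<close> is an algebra homomorphism.\<close>

section \<open>Categories of structured objects and lifted monads\<close>

lemma hom_structured_cat:
  "t \<in> hom (structured_cat C S U P) x y \<longleftrightarrow>
     (\<exists>h. t = (x, h, y) \<and> x \<in> S \<and> y \<in> S \<and> h \<in> hom C (U x) (U y) \<and> P x h y)"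
  by (auto simp: hom_def structured_cat_def)

lemma Ob_structured_cat: "Ob (structured_cat C S U P) = S"
  by (simp add: structured_cat_def)

lemma Id_structured_cat: "Id (structured_cat C S U P) x = (x, Id C (U x), x)"
  by (simp add: structured_cat_def)

lemma Comp_structured_cat:
  "(y', g, z) \<cdot>\<^bsub>structured_cat C S U P\<^esub> (x, f, y) = (x, g \<cdot>\<^bsub>C\<^esub> f, z)"
  by (simp add: structured_cat_def)

lemmas structured_cat_simps =
  hom_structured_cat Ob_structured_cat Id_structured_cat Comp_structured_cat

text \<open>Source and target tags compose by construction, so each category law reduces to the law
  of \<open>C\<close> on the middle component. \<open>P_Id\<close> and \<open>P_Comp\<close> supply
  the closure of the arrows.\<close>

lemma category_structured_cat:
  fixes C :: "('o, 'm) cat" (structure)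
  assumes "category C"
    and U: "\<And>x. x \<in> S \<Longrightarrow> U x \<in> Ob C"
    and P_Id: "\<And>x. x \<in> S \<Longrightarrow> P x (Id C (U x)) x"
    and P_Comp: "\<And>x y z f g. x \<in> S \<Longrightarrow> y \<in> S \<Longrightarrow> z \<in> S \<Longrightarrow> f \<in> hom C (U x) (U y) \<Longrightarrow>
      g \<in> hom C (U y) (U z) \<Longrightarrow> P x f y \<Longrightarrow> P y g z \<Longrightarrow> P x (g \<cdot> f) z"
  shows "category (structured_cat C S U P)"
proof -
  interpret category C by fact
  show ?thesis
  proof (unfold_locales, goal_cases)
    case (1 f) then show ?case by (auto simp: structured_cat_def)
  next
    case (2 f) then show ?case by (auto simp: structured_cat_def)
  next
    case (3 x) then show ?case by (auto simp: structured_cat_simps Id_in_hom U P_Id)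
  next
    case (4 f x y g z) then show ?case
      by (auto simp: structured_cat_simps intro: Comp_in_hom P_Comp)
  next
    case (5 f w x g y h z) then show ?case
      by (auto simp: structured_cat_simps Comp_assoc)
  next
    case (6 f x y) then show ?case by (auto simp: structured_cat_simps Id_left)
  next
    case (7 f x y) then show ?case by (auto simp: structured_cat_simps Id_right)
  qed
qed

text \<open>\<open>UQ\<close> is an equality of objects, so \<open>Q (Q x)\<close> lies over
  \<open>T (T (U x))\<close> and the components of \<mu> and \<eta> at \<open>U x\<close> have the
  right type. In every monad equation the tags agree, and the middle component is the corresponding
  equation in \<open>C\<close> at \<open>U x\<close>.\<close>

lemma monad_structured_cat:
  fixes C :: "('o, 'm) cat"
  assumes "monad C T \<mu> \<eta>"
    and cat: "category (structured_cat C S U P)"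
    and U: "\<And>x. x \<in> S \<Longrightarrow> U x \<in> Ob C"
    and Q: "\<And>x. x \<in> S \<Longrightarrow> Q x \<in> S"
    and UQ: "\<And>x. x \<in> S \<Longrightarrow> U (Q x) = on_ob T (U x)"
    and P_T: "\<And>x y h. x \<in> S \<Longrightarrow> y \<in> S \<Longrightarrow> h \<in> hom C (U x) (U y) \<Longrightarrow> P x h y \<Longrightarrow>
      P (Q x) (on_arr T h) (Q y)"
    and P_mult: "\<And>x. x \<in> S \<Longrightarrow> P (Q (Q x)) (\<mu> (U x)) (Q x)"
    and P_unit: "\<And>x. x \<in> S \<Longrightarrow> P x (\<eta> (U x)) (Q x)"
  shows "monad (structured_cat C S U P)
    \<lparr>on_ob = Q, on_arr = (\<lambda>(x, h, y). (Q x, on_arr T h, Q y))\<rparr>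
    (\<lambda>x. (Q (Q x), \<mu> (U x), Q x)) (\<lambda>x. (x, \<eta> (U x), Q x))"
    (is "monad ?S ?T ?\<mu> ?\<eta>")
proof -
  interpret monad C T \<mu> \<eta> by fact
  interpret S: category ?S by fact
  interpret T': is_functor ?S ?S ?T
  proof (unfold_locales, goal_cases)
    case (1 x) then show ?case by (simp add: structured_cat_simps Q)
  next
    case (2 f x y) then show ?case
      by (auto simp: structured_cat_simps Q UQ P_T T.on_arr_in_hom)
  next
    case (3 x) then show ?case by (simp add: structured_cat_simps UQ U T.on_arr_Id)
  next
    case (4 f x y g z) then show ?case
      by (auto simp: structured_cat_simps T.on_arr_Comp)
  qed
  have mult_hom: "\<mu> X \<in> hom C (on_ob T (on_ob T X)) (on_ob T X)" if "X \<in> Ob C" for X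
    using \<mu>.component_in_hom[OF that] by (simp add: comp_functor_def)
  have unit_hom: "\<eta> X \<in> hom C X (on_ob T X)" if "X \<in> Ob C" for X
    using \<eta>.component_in_hom[OF that] by (simp add: id_functor_def)
  \<comment> \<open>The goals come in blocks: 1-4 functoriality of the squared lifted functor, 5-6
    the multiplication, 7-10 the identity functor, 11-12 the unit, 13-15 the monad laws.\<close>
  show ?thesis
  proof (unfold_locales, goal_cases)
    case (1 x) then show ?case by (simp add: structured_cat_simps comp_functor_def Q)
  next
    case (2 f x y) then show ?case
      by (auto simp: structured_cat_simps comp_functor_def Q UQ P_T T.on_arr_in_hom)
  next
    case (3 x) then show ?case
      by (simp add: structured_cat_simps comp_functor_def Q UQ U T.on_arr_Id T.on_ob_in_Ob)
  next
    \<comment> \<open>Preservation of composites is used twice; the instantiated rule serves the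
      outer \<open>T\<close>, whose arguments are themselves images under \<open>T\<close>.\<close>
    case (4 f x y g z) then show ?case
      by (auto simp: structured_cat_simps comp_functor_def
          T.on_arr_Comp[OF T.on_arr_in_hom T.on_arr_in_hom] T.on_arr_Comp)
  next
    case (5 x) then show ?case
      by (simp add: structured_cat_simps comp_functor_def Q UQ U mult_hom P_mult)
  next
    case (6 f x y) then show ?case
      using \<mu>.naturality
      by (auto simp: structured_cat_simps comp_functor_def)
  next
    case (7 x) then show ?case by (simp add: id_functor_def)
  next
    case (8 f x y) then show ?case by (simp add: id_functor_def)
  next
    case (9 x) then show ?case by (simp add: id_functor_def)
  next
    case (10 f x y g z) then show ?case by (simp add: id_functor_def)
  next
    case (11 x) then show ?case
      by (simp add: structured_cat_simps id_functor_def Q UQ U unit_hom P_unit)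
  next
    case (12 f x y) then show ?case
      using \<eta>.naturality
      by (auto simp: structured_cat_simps id_functor_def)
  next
    case (13 x) then show ?case
      by (simp add: structured_cat_simps Q UQ U mult_assoc)
  next
    case (14 x) then show ?case
      by (simp add: structured_cat_simps UQ U unit_left)
  next
    case (15 x) then show ?case
      by (simp add: structured_cat_simps UQ U unit_right)
  qed
qed

section \<open>Bloom algebras as structured objects\<close>

abbreviation bloom_hom ::
    "('o, 'm) cat \<Rightarrow> ('o, 'm, 'o, 'm) fctr \<Rightarrow> 'm bloom \<Rightarrow> 'm \<Rightarrow> 'm bloom \<Rightarrow> bool" where
  "bloom_hom C F A h B \<equiv>
     alg_square C F (fst A) h (fst B) \<and> (\<forall>e \<in> coalgebras C F. h \<cdot>\<^bsub>C\<^esub> snd A e = snd B e)"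

text \<open>With projections in place of pair patterns, the morphism condition unfolds for a
  variable Bloom algebra without splitting it.\<close>

lemma Alg_B_eq:
  "Alg_B C F = structured_cat C (bloom_algebras C F) (bloom_carrier C) (bloom_hom C F)"
  by (simp add: Alg_B_def case_prod_unfold)

lemma algebra_in_hom:
  "a \<in> algebras C F \<Longrightarrow> a \<in> hom C (on_ob F (Cod C a)) (Cod C a)"
  by (simp add: algebras_def hom_def)

lemma algebra_of_hom:
  "a \<in> hom C (on_ob F A) A \<Longrightarrow> a \<in> algebras C F"
  by (auto simp: algebras_def hom_def)

lemma coalgebra_in_hom:
  "e \<in> coalgebras C F \<Longrightarrow> e \<in> hom C (Dom C e) (on_ob F (Dom C e))"
  by (simp add: coalgebras_def hom_def)

lemma (in category) ends_in_Ob: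
  "f \<in> hom C X Y \<Longrightarrow> X \<in> Ob C" "f \<in> hom C X Y \<Longrightarrow> Y \<in> Ob C"
  using Dom_in_Ob Cod_in_Ob by (auto simp: hom_def)

lemma alg_square_Id:
  assumes "is_functor C C F" and a: "a \<in> hom C (on_ob F X) X"
  shows "alg_square C F a (Id C X) a"
proof -
  interpret is_functor C C F by fact
  show ?thesis
    using a by (simp add: alg_square_def on_arr_Id C.ends_in_Ob C.Id_left C.Id_right)
qed

text \<open>The two squares are pasted along \<open>b\<close>. Associativity holds only for
  composable arrows, so each rebracketing is instantiated with typing facts.\<close>

lemma alg_square_Comp:
  fixes C :: "('o, 'm) cat" (structure)
  assumes "is_functor C C F"
    and a: "a \<in> hom C (on_ob F X) X" and b: "b \<in> hom C (on_ob F Y) Y"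
    and c: "c \<in> hom C (on_ob F Z) Z"
    and f: "f \<in> hom C X Y" and g: "g \<in> hom C Y Z"
    and sq: "alg_square C F a f b" "alg_square C F b g c"
  shows "alg_square C F a (g \<cdot> f) c"
proof -
  interpret is_functor C C F by fact
  have "c \<cdot> on_arr F (g \<cdot> f) = c \<cdot> on_arr F g \<cdot> on_arr F f"
    using C.Comp_assoc[OF on_arr_in_hom[OF f] on_arr_in_hom[OF g] c]
    by (simp add: on_arr_Comp[OF f g])
  also have "\<dots> = g \<cdot> (b \<cdot> on_arr F f)"
    using sq C.Comp_assoc[OF on_arr_in_hom[OF f] b g] by (simp add: alg_square_def)
  also have "\<dots> = g \<cdot> f \<cdot> a"
    using sq C.Comp_assoc[OF a f g] by (simp add: alg_square_def)
  finally show ?thesis by (simp add: alg_square_def)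
qed

lemma bloom_algebraD:
  fixes C :: "('o, 'm) cat" (structure)
  assumes "A \<in> bloom_algebras C F"
  shows bloom_structure: "fst A \<in> hom C (on_ob F (bloom_carrier C A)) (bloom_carrier C A)"
    and bloom_dagger_in_hom:
      "e \<in> coalgebras C F \<Longrightarrow> snd A e \<in> hom C (Dom C e) (bloom_carrier C A)"
    and bloom_solution:
      "e \<in> coalgebras C F \<Longrightarrow> snd A e = fst A \<cdot> on_arr F (snd A e) \<cdot> e"
    and bloom_functorial:
      "e \<in> coalgebras C F \<Longrightarrow> f \<in> coalgebras C F \<Longrightarrow> h \<in> hom C (Dom C e) (Dom C f) \<Longrightarrow>
        coalg_square C F e h f \<Longrightarrow> snd A f \<cdot> h = snd A e"
  using assms by (auto simp: bloom_algebras_def bloom_carrier_def algebra_in_hom PiE_iff)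

text \<open>Algebra squares paste, and dagger preservation composes: \<open>g\<close> after
  \<open>f\<close> sends the first dagger to the second, then to the third.\<close>

lemma category_Alg_B:
  fixes C :: "('o, 'm) cat" (structure)
  assumes "is_functor C C F"
  shows "category (Alg_B C F)"
proof -
  interpret is_functor C C F by fact
  show ?thesis
    unfolding Alg_B_eq
  proof (rule category_structured_cat, goal_cases)
    case 1 show ?case by (fact C.category_axioms)
  next
    case (2 A) then show ?case by (blast dest: bloom_structure C.ends_in_Ob)
  next
    case (3 A) then show ?case
      using bloom_dagger_in_hom[OF 3] alg_square_Id[OF assms bloom_structure[OF 3]]
      by (auto intro: C.Id_left)
  next
    case (4 A B D f g)
    have "alg_square C F (fst A) (g \<cdot> f) (fst D)"
      using 4 by (blast intro: alg_square_Comp[OF assms] bloom_structure)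
    moreover have "g \<cdot> f \<cdot> snd A e = snd D e" if "e \<in> coalgebras C F" for e
      using 4 that C.Comp_assoc[OF bloom_dagger_in_hom[OF 4(1) that] 4(4,5)] by simp
    ultimately show ?case by blast
  qed
qed

section \<open>Lifting the monad to \<open>F\<close>-algebras along the distributive law\<close>

context distributive_law
begin

lemmas comp_hom = F.C.Comp_in_hom
lemmas comp_assoc = F.C.Comp_assoc
lemmas F_hom = F.on_arr_in_hom
lemmas T_hom = T.T.on_arr_in_hom
lemmas in_Ob = F.C.ends_in_Ob

text \<open>This and the facts through \<open>lam_natural\<close> restate the locale facts with
  composite and identity functors unfolded, so that they chain with plain typing facts.\<close>

lemma mult_in_hom: "X \<in> Ob C \<Longrightarrow> \<mu> X \<in> hom C (on_ob T (on_ob T X)) (on_ob T X)"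
  using T.\<mu>.component_in_hom by (simp add: comp_functor_def)

lemma unit_in_hom: "X \<in> Ob C \<Longrightarrow> \<eta> X \<in> hom C X (on_ob T X)"
  using T.\<eta>.component_in_hom by (simp add: id_functor_def)

lemma lam_in_hom: "X \<in> Ob C \<Longrightarrow> lam X \<in> hom C (on_ob F (on_ob T X)) (on_ob T (on_ob F X))"
  using lam.component_in_hom by (simp add: comp_functor_def)

lemma mult_natural:
  "f \<in> hom C X Y \<Longrightarrow> on_arr T f \<cdot> \<mu> X = \<mu> Y \<cdot> on_arr T (on_arr T f)"
  using T.\<mu>.naturality by (simp add: comp_functor_def)

lemma unit_natural: "f \<in> hom C X Y \<Longrightarrow> on_arr T f \<cdot> \<eta> X = \<eta> Y \<cdot> f"
  using T.\<eta>.naturality by (simp add: id_functor_def)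

lemma lam_natural:
  "f \<in> hom C X Y \<Longrightarrow> on_arr T (on_arr F f) \<cdot> lam X = lam Y \<cdot> on_arr F (on_arr T f)"
  using lam.naturality by (simp add: comp_functor_def)

text \<open>\<open>Tbar\<close> reads its carrier off as \<open>Cod C a\<close>; a typed
  \<open>a\<close> gives that carrier a name.\<close>

lemma Tbar_eq: "a \<in> hom C (on_ob F X) X \<Longrightarrow> Tbar C T lam a = on_arr T a \<cdot> lam X"
  by (auto simp: Tbar_def hom_def)

lemma Tbar_in_hom:
  assumes "a \<in> hom C (on_ob F X) X"
  shows "Tbar C T lam a \<in> hom C (on_ob F (on_ob T X)) (on_ob T X)"
  using assms by (auto simp: Tbar_eq intro: comp_hom T_hom lam_in_hom in_Ob)

text \<open>Two squares are pasted: naturality of \<open>lam\<close> at \<open>h\<close>, and the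
  image under \<open>T\<close> of the square for \<open>h\<close>.\<close>

lemma alg_square_Tbar:
  assumes a: "a \<in> hom C (on_ob F X) X" and b: "b \<in> hom C (on_ob F Y) Y"
    and h: "h \<in> hom C X Y" and sq: "alg_square C F a h b"
  shows "alg_square C F (Tbar C T lam a) (on_arr T h) (Tbar C T lam b)"
proof -
  note lamX = lam_in_hom[OF in_Ob(1)[OF h]] and lamY = lam_in_hom[OF in_Ob(2)[OF h]]
  have "on_arr T b \<cdot> lam Y \<cdot> on_arr F (on_arr T h) = on_arr T b \<cdot> (on_arr T (on_arr F h) \<cdot> lam X)"
    by (simp add: lam_natural[OF h] comp_assoc[OF F_hom[OF T_hom[OF h]] lamY T_hom[OF b]])
  also have "\<dots> = on_arr T (b \<cdot> on_arr F h) \<cdot> lam X"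
    by (simp add: comp_assoc[OF lamX T_hom[OF F_hom[OF h]] T_hom[OF b]]
        T.T.on_arr_Comp[OF F_hom[OF h] b])
  also have "\<dots> = on_arr T (h \<cdot> a) \<cdot> lam X"
    using sq by (simp add: alg_square_def)
  also have "\<dots> = on_arr T h \<cdot> (on_arr T a \<cdot> lam X)"
    by (simp add: comp_assoc[OF lamX T_hom[OF a] T_hom[OF h]] T.T.on_arr_Comp[OF a h])
  finally show ?thesis
    by (simp add: alg_square_def Tbar_eq[OF a] Tbar_eq[OF b])
qed

text \<open>The unit axiom turns \<open>lam X\<close> after \<open>F\<close> of \<eta> into \<eta>
  at \<open>F X\<close>; naturality of \<eta> at \<open>a\<close> does the rest.\<close>

lemma alg_square_unit:
  assumes a: "a \<in> hom C (on_ob F X) X"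
  shows "alg_square C F a (\<eta> X) (Tbar C T lam a)"
proof -
  note X = in_Ob(2)[OF a]
  have "on_arr T a \<cdot> lam X \<cdot> on_arr F (\<eta> X) = on_arr T a \<cdot> \<eta> (on_ob F X)"
    by (simp add: lam_unit[OF X]
        comp_assoc[OF F_hom[OF unit_in_hom[OF X]] lam_in_hom[OF X] T_hom[OF a], symmetric])
  then show ?thesis
    by (simp add: alg_square_def Tbar_eq[OF a] unit_natural[OF a])
qed

text \<open>The multiplication axiom of \<open>lam\<close> brings \<mu> to \<open>F X\<close>,
  naturality at \<open>a\<close> moves it to the front, and what remains is the twice lifted
  structure.\<close>

lemma alg_square_mult:
  assumes a: "a \<in> hom C (on_ob F X) X"
  shows "alg_square C F (Tbar C T lam (Tbar C T lam a)) (\<mu> X) (Tbar C T lam a)"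
proof -
  note X = in_Ob(2)[OF a] and FX = in_Ob(1)[OF a]
  note TX = T.T.on_ob_in_Ob[OF X]
  note lamX = lam_in_hom[OF X] and lamTX = lam_in_hom[OF TX]
  note TTa = T_hom[OF T_hom[OF a]] and Tlam = T_hom[OF lamX]
  have "on_arr T a \<cdot> lam X \<cdot> on_arr F (\<mu> X)
      = on_arr T a \<cdot> (\<mu> (on_ob F X) \<cdot> on_arr T (lam X) \<cdot> lam (on_ob T X))"
    by (simp add: lam_mult[OF X]
        comp_assoc[OF F_hom[OF mult_in_hom[OF X]] lamX T_hom[OF a], symmetric])
  \<comment> \<open>Composition associates to the left, so this exposes \<open>on_arr T a\<close>
    next to \<mu> as a leading factor for naturality.\<close>
  also have "\<dots> = on_arr T a \<cdot> \<mu> (on_ob F X) \<cdot> on_arr T (lam X) \<cdot> lam (on_ob T X)"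
    by (simp add: comp_assoc[OF lamTX comp_hom[OF Tlam mult_in_hom[OF FX]] T_hom[OF a]]
        comp_assoc[OF Tlam mult_in_hom[OF FX] T_hom[OF a]])
  also have "\<dots> = \<mu> X \<cdot> on_arr T (on_arr T a) \<cdot> on_arr T (lam X) \<cdot> lam (on_ob T X)"
    by (simp add: mult_natural[OF a])
  also have "\<dots> = \<mu> X \<cdot> (on_arr T (on_arr T a \<cdot> lam X) \<cdot> lam (on_ob T X))"
    by (simp add: comp_assoc[OF lamTX comp_hom[OF Tlam TTa] mult_in_hom[OF X]]
        comp_assoc[OF Tlam TTa mult_in_hom[OF X]] T.T.on_arr_Comp[OF lamX T_hom[OF a]])
  \<comment> \<open>The rule for the outer \<open>Tbar\<close> is itself unfolded so that its left
    side still matches once the inner \<open>Tbar\<close> has been rewritten.\<close>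
  finally show ?thesis
    by (simp add: alg_square_def Tbar_eq[OF Tbar_in_hom[OF a], unfolded Tbar_eq[OF a]] Tbar_eq[OF a])
qed

section \<open>The lifted dagger and the monad on Bloom algebras\<close>

lemma fst_Tbar_B_ob: "fst (Tbar_B_ob C F T \<eta> lam A) = Tbar C T lam (fst A)"
  by (simp add: Tbar_B_ob_def case_prod_unfold)

lemma snd_Tbar_B_ob:
  "e \<in> coalgebras C F \<Longrightarrow> snd (Tbar_B_ob C F T \<eta> lam A) e = \<eta> (bloom_carrier C A) \<cdot> snd A e"
  by (simp add: Tbar_B_ob_def case_prod_unfold bloom_carrier_def)

lemma bloom_carrier_Tbar_B_ob:
  "A \<in> bloom_algebras C F \<Longrightarrow>
     bloom_carrier C (Tbar_B_ob C F T \<eta> lam A) = on_ob T (bloom_carrier C A)"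
  using Tbar_in_hom[OF bloom_structure]
  by (fastforce simp: bloom_carrier_def fst_Tbar_B_ob hom_def)

text \<open>An algebra homomorphism carries solutions to solutions, here \<eta> from
  \<open>a\<close> to \<open>Tbar C T lam a\<close>. Compatibility with coalgebra homomorphisms
  concerns precomposition only and so survives postcomposition with \<eta>.\<close>

lemma Tbar_B_ob_in_bloom_algebras:
  assumes A: "A \<in> bloom_algebras C F"
  shows "Tbar_B_ob C F T \<eta> lam A \<in> bloom_algebras C F"
proof -
  define X where "X = bloom_carrier C A"
  define a where "a = fst A"
  define s where "s = snd A"
  have a: "a \<in> hom C (on_ob F X) X"
    unfolding a_def X_def using A by (rule bloom_structure)
  have Cod_a: "Cod C a = X"
    using a by (simp add: hom_def)
  note unit = unit_in_hom[OF in_Ob(2)[OF a]] and Ta = Tbar_in_hom[OF a]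
  have s: "s e \<in> hom C (Dom C e) X" if "e \<in> coalgebras C F" for e
    unfolding s_def X_def using A that by (rule bloom_dagger_in_hom)
  have sol: "\<eta> X \<cdot> s e = Tbar C T lam a \<cdot> on_arr F (\<eta> X \<cdot> s e) \<cdot> e"
    if e: "e \<in> coalgebras C F" for e
  proof -
    note Fs = F_hom[OF s[OF e]] and eh = coalgebra_in_hom[OF e]
    have "\<eta> X \<cdot> s e = \<eta> X \<cdot> (a \<cdot> on_arr F (s e) \<cdot> e)"
      using bloom_solution[OF A e] by (simp add: a_def s_def)
    also have "\<dots> = \<eta> X \<cdot> a \<cdot> on_arr F (s e) \<cdot> e"
      by (simp add: comp_assoc[OF eh comp_hom[OF Fs a] unit] comp_assoc[OF Fs a unit])
    also have "\<dots> = Tbar C T lam a \<cdot> on_arr F (\<eta> X) \<cdot> on_arr F (s e) \<cdot> e"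
      using alg_square_unit[OF a] by (simp add: alg_square_def)
    also have "\<dots> = Tbar C T lam a \<cdot> on_arr F (\<eta> X \<cdot> s e) \<cdot> e"
      by (simp add: comp_assoc[OF Fs F_hom[OF unit] Ta] F.on_arr_Comp[OF s[OF e] unit])
    finally show ?thesis .
  qed
  have natural: "\<eta> X \<cdot> s f \<cdot> h = \<eta> X \<cdot> s e"
    if ef: "e \<in> coalgebras C F" "f \<in> coalgebras C F"
      and h: "h \<in> hom C (Dom C e) (Dom C f)" "coalg_square C F e h f" for e f h
    using bloom_functorial[OF A ef h] comp_assoc[OF h(1) s[OF ef(2)] unit] by (simp add: s_def)
  \<comment> \<open>The restricted abstraction makes the new dagger \<open>undefined\<close> off
    coalgebras, as the extensional function space demands.\<close>
  have "Tbar_B_ob C F T \<eta> lam A = (Tbar C T lam a, \<lambda>e\<in>coalgebras C F. \<eta> X \<cdot> s e)"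
    by (simp add: Tbar_B_ob_def case_prod_unfold a_def s_def X_def bloom_carrier_def)
  moreover have "Cod C (Tbar C T lam a) = on_ob T X"
    using Ta by (simp add: hom_def)
  ultimately show ?thesis
    using algebra_of_hom[OF Ta] comp_hom[OF s unit] sol natural
    by (auto simp: bloom_algebras_def)
qed

theorem monad_Alg_B:
  "monad (Alg_B C F) (Tbar_B C F T \<eta> lam) (mu_B C F T \<mu> \<eta> lam) (eta_B C F T \<eta> lam)"
proof -
  let ?Q = "Tbar_B_ob C F T \<eta> lam" and ?U = "bloom_carrier C"
  \<comment> \<open>Both transformations are put into the triple form that
    \<open>monad_structured_cat\<close> produces.\<close>
  have mu: "mu_B C F T \<mu> \<eta> lam = (\<lambda>A. (?Q (?Q A), \<mu> (?U A), ?Q A))"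
    by (rule ext) (simp add: mu_B_def Tbar_B_def Let_def)
  have eta: "eta_B C F T \<eta> lam = (\<lambda>A. (A, \<eta> (?U A), ?Q A))"
    by (rule ext) (simp add: eta_B_def Tbar_B_def Let_def)
  note Q = Tbar_B_ob_in_bloom_algebras
  note ob = bloom_carrier_Tbar_B_ob fst_Tbar_B_ob snd_Tbar_B_ob
  show ?thesis
    unfolding mu eta Alg_B_eq Tbar_B_def
  proof (rule monad_structured_cat, goal_cases)
    case 1 show ?case by (fact T.monad_axioms)
  next
    case 2 show ?case
      using category_Alg_B[OF F.is_functor_axioms] by (simp add: Alg_B_eq)
  next
    case (3 A) then show ?case by (blast dest: bloom_structure in_Ob)
  next
    case (4 A) then show ?case by (rule Q)
  next
    case (5 A) then show ?case by (rule bloom_carrier_Tbar_B_ob)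
  next
    case (6 A B h)
    note X = in_Ob(1)[OF 6(3)] and Y = in_Ob(2)[OF 6(3)]
    \<comment> \<open>Naturality of \<eta> brings \<open>h\<close> directly onto the dagger of
      \<open>A\<close>, which it preserves by assumption.\<close>
    have "on_arr T h \<cdot> (\<eta> (?U A) \<cdot> snd A e) = \<eta> (?U B) \<cdot> snd B e" if e: "e \<in> coalgebras C F" for e
    proof -
      note s = bloom_dagger_in_hom[OF 6(1) e]
      have "on_arr T h \<cdot> (\<eta> (?U A) \<cdot> snd A e) = \<eta> (?U B) \<cdot> h \<cdot> snd A e"
        by (simp add: comp_assoc[OF s unit_in_hom[OF X] T_hom[OF 6(3)]] unit_natural[OF 6(3)])
      also have "\<dots> = \<eta> (?U B) \<cdot> snd B e"
        using 6(4) e comp_assoc[OF s 6(3) unit_in_hom[OF Y]] by simp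
      finally show ?thesis .
    qed
    moreover have "alg_square C F (Tbar C T lam (fst A)) (on_arr T h) (Tbar C T lam (fst B))"
      using 6 by (blast intro: alg_square_Tbar bloom_structure)
    ultimately show ?case by (simp add: ob)
  next
    case (7 A)
    have X: "?U A \<in> Ob C" using bloom_structure[OF 7] by (rule in_Ob)
    note TX = T.T.on_ob_in_Ob[OF X]
    \<comment> \<open>Each application of the lifted functor prefixes one unit to the dagger; the
      left unit law cancels the outer of the two.\<close>
    have "\<mu> (?U A) \<cdot> (\<eta> (on_ob T (?U A)) \<cdot> (\<eta> (?U A) \<cdot> snd A e)) = \<eta> (?U A) \<cdot> snd A e"
      if e: "e \<in> coalgebras C F" for e
    proof -
      note s = comp_hom[OF bloom_dagger_in_hom[OF 7 e] unit_in_hom[OF X]]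
      show ?thesis
        by (simp add: comp_assoc[OF s unit_in_hom[OF TX] mult_in_hom[OF X]] T.unit_left[OF X]
            F.C.Id_left[OF s])
    qed
    then show ?case
      using alg_square_mult[OF bloom_structure[OF 7]] by (simp add: ob 7)
  next
    \<comment> \<open>The dagger condition for \<eta> is the definition of the new dagger, so only
      the algebra square needs a fact.\<close>
    case (8 A) then show ?case
      using alg_square_unit[OF bloom_structure[OF 8]] by (simp add: ob)
  qed
qed

end

theorem theorem4p8:
  fixes C :: "('o, 'm) cat"
    and F T :: "('o, 'm, 'o, 'm) fctr"
    and \<mu> \<eta> lam :: "'o \<Rightarrow> 'm"
  assumes "category C"
    and "has_binary_coproducts C"
    and "is_functor C C F"
    and "monad C T \<mu> \<eta>"
    and "distributive_law C F T \<mu> \<eta> lam"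
    and "\<forall>X \<in> Ob C. \<exists>i. initial (Alg C (plus_const C F X)) i"
    and "\<exists>t. terminal (Coalg C F) t"
    and "has_binary_coproducts (Alg C F)"
  shows "monad (Alg_B C F) (Tbar_B C F T \<eta> lam) (mu_B C F T \<mu> \<eta> lam) (eta_B C F T \<eta> lam)"
  using assms(5) by (rule distributive_law.monad_Alg_B)

end
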